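(* Let $\gamma$ be a hereditary Plotkin radical such that $\mathrm{F}^*(G)\subseteq\gamma(G)$ for every finite group $G$ with $h_\gamma(G)<\infty$. If $M$ is a maximal subgroup of a finite group $G$ and $h_\gamma(G)<\infty$, $h_\gamma(M)<\infty$, then $h_\gamma(G)-h_\gamma(M)\leq 2$.
   Context: All groups are finite. $\mathrm{F}^*(G)$ denotes the generalized Fitting subgroup of $G$. A functorial is a function $\gamma$ assigning to each (finite) group $G$ a subgroup $\gamma(G)$ of $G$ such that $f(\gamma(G))=\gamma(f(G))$ for every isomorphism $f:G\to G^*$ (so $\gamma(G)$ is characteristic in $G$). A functorial $\gamma$ is a hereditary Plotkin radical if: (P1) $f(\gamma(G))\subseteq\gamma(f(G))$ for every epimorphism $f:G\to G^*$; (P2) $\gamma(G)\cap N=\gamma(N)$ for every $N\trianglelefteq G$. The $\gamma$-series of $G$ is defined by $\gamma_{(0)}(G)=1$ and $\gamma_{(i+1)}(G)/\gamma_{(i)}(G)=\gamma(G/\gamma_{(i)}(G))$. The $\gamma$-length $h_\gamma(G)$ is the least $h\geq 0$ with $\gamma_{(h)}(G)=G$, and $h_\gamma(G)=\infty$ if there is no such $h$. *)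

theory Defs
  imports "HOL-Algebra.Algebra" "HOL-Library.Extended_Nat"
begin

definition maximal_subgroup :: "'a set \<Rightarrow> ('a, 'b) monoid_scheme \<Rightarrow> bool" where
  "maximal_subgroup M G \<longleftrightarrow>
     subgroup M G \<and> M \<noteq> carrier G \<and>
     (\<forall>K. subgroup K G \<and> M \<subseteq> K \<longrightarrow> K = M \<or> K = carrier G)"

definition centre :: "('a, 'b) monoid_scheme \<Rightarrow> 'a set" where
  "centre G = {z \<in> carrier G. \<forall>x\<in>carrier G. z \<otimes>\<^bsub>G\<^esub> x = x \<otimes>\<^bsub>G\<^esub> z}"

primrec lower_central :: "('a, 'b) monoid_scheme \<Rightarrow> nat \<Rightarrow> 'a set" where
  "lower_central G 0 = carrier G"
| "lower_central G (Suc n) = generate G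
     {x \<otimes>\<^bsub>G\<^esub> y \<otimes>\<^bsub>G\<^esub> inv\<^bsub>G\<^esub> x \<otimes>\<^bsub>G\<^esub> inv\<^bsub>G\<^esub> y | x y. x \<in> lower_central G n \<and> y \<in> carrier G}"

definition nilpotent_group :: "('a, 'b) monoid_scheme \<Rightarrow> bool" where
  "nilpotent_group G \<longleftrightarrow> group G \<and> (\<exists>n. lower_central G n = {\<one>\<^bsub>G\<^esub>})"

definition Fitting :: "('a, 'b) monoid_scheme \<Rightarrow> 'a set" where
  "Fitting G = generate G (\<Union>{N. N \<lhd> G \<and> nilpotent_group (G\<lparr>carrier := N\<rparr>)})"

inductive subnormal :: "('a, 'b) monoid_scheme \<Rightarrow> 'a set \<Rightarrow> bool" for G where
  subnormal_carrier: "subnormal G (carrier G)"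
| subnormal_step: "subnormal G K \<Longrightarrow> H \<lhd> G\<lparr>carrier := K\<rparr> \<Longrightarrow> subnormal G H"

definition quasisimple_group :: "('a, 'b) monoid_scheme \<Rightarrow> bool" where
  "quasisimple_group G \<longleftrightarrow>
     group G \<and> derived G (carrier G) = carrier G \<and> simple_group (G Mod centre G)"

text \<open>The layer \<open>E(G)\<close>: the subgroup generated by the components of \<open>G\<close>, that is, by
  the subnormal quasisimple subgroups of \<open>G\<close>.\<close>

definition layer :: "('a, 'b) monoid_scheme \<Rightarrow> 'a set" where
  "layer G = generate G (\<Union>{K. subnormal G K \<and> quasisimple_group (G\<lparr>carrier := K\<rparr>)})"

definition gen_Fitting :: "('a, 'b) monoid_scheme \<Rightarrow> 'a set" where
  "gen_Fitting G = Fitting G <#>\<^bsub>G\<^esub> layer G"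

text \<open>A functorial assigns a subgroup to every finite group. Every finite group is isomorphic to
  one whose elements are natural numbers, so a functorial is given by its values on the finite
  groups of type \<^typ>\<open>nat monoid\<close>; \<open>radical\<close> below is its unique isomorphism-invariant extension
  to finite groups over arbitrary types. Values at other arguments are irrelevant.\<close>

type_synonym group_function = "nat monoid \<Rightarrow> nat set"

definition functorial :: "group_function \<Rightarrow> bool" where
  "functorial \<gamma> \<longleftrightarrow>
     (\<forall>G. group G \<and> finite (carrier G) \<longrightarrow> subgroup (\<gamma> G) G) \<and>
     (\<forall>G H f. group G \<and> finite (carrier G) \<and> group H \<and> f \<in> iso G H \<longrightarrow> f ` \<gamma> G = \<gamma> H)"

definition hereditary_Plotkin_radical :: "group_function \<Rightarrow> bool" where
  "hereditary_Plotkin_radical \<gamma> \<longleftrightarrow>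
     functorial \<gamma> \<and>
     (\<forall>G H f. group G \<and> finite (carrier G) \<and> group H \<and> f \<in> epi G H \<longrightarrow> f ` \<gamma> G \<subseteq> \<gamma> H) \<and>
     (\<forall>G N. group G \<and> finite (carrier G) \<and> N \<lhd> G \<longrightarrow> \<gamma> G \<inter> N = \<gamma> (G\<lparr>carrier := N\<rparr>))"

definition radical :: "group_function \<Rightarrow> ('a, 'b) monoid_scheme \<Rightarrow> 'a set" where
  "radical \<gamma> G = {x \<in> carrier G. \<exists>(H :: nat monoid) f. group H \<and> f \<in> iso G H \<and> f x \<in> \<gamma> H}"

lemma radical_iso:
  fixes G :: "('a, 'b) monoid_scheme" and H :: "nat monoid"
  assumes \<gamma>: "functorial \<gamma>" and G: "group G" "finite (carrier G)" and H: "group H"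
    and f: "f \<in> iso G H"
  shows "f ` radical \<gamma> G = \<gamma> H"
proof -
  have bij: "bij_betw f (carrier G) (carrier H)"
    using f by (simp add: iso_def)
  then have fin: "finite (carrier H)"
    using G(2) bij_betw_finite by blast
  have sub: "\<gamma> H \<subseteq> carrier H"
    using \<gamma> H fin subgroup.subset unfolding functorial_def by blast
  have "f x \<in> \<gamma> H"
    if x: "x \<in> carrier G" and K: "group K" "g \<in> iso G K" "g x \<in> \<gamma> K" for x g and K :: "nat monoid"
  proof -
    have "inv_into (carrier G) g \<in> iso K G"
      using group.iso_set_sym[OF G(1) K(2)] .
    then have h: "f \<circ> inv_into (carrier G) g \<in> iso K H"
      using f iso_set_trans by blast
    have "finite (carrier K)"
      using K(2) G(2) bij_betw_finite unfolding iso_def by blast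
    then have "(f \<circ> inv_into (carrier G) g) ` \<gamma> K = \<gamma> H"
      using \<gamma> K(1) H h unfolding functorial_def by blast
    moreover have "inv_into (carrier G) g (g x) = x"
      using x K(2) by (simp add: iso_def bij_betw_def)
    ultimately show ?thesis
      using K(3) by (metis comp_apply imageI)
  qed
  then have "f ` radical \<gamma> G \<subseteq> \<gamma> H"
    unfolding radical_def by blast
  moreover have "\<gamma> H \<subseteq> f ` radical \<gamma> G"
  proof
    fix y assume y: "y \<in> \<gamma> H"
    then obtain x where "x \<in> carrier G" "y = f x"
      using sub bij unfolding bij_betw_def by blast
    then show "y \<in> f ` radical \<gamma> G"
      using y H f unfolding radical_def by blast
  qed
  ultimately show ?thesis
    by blast
qed

lemma radical_nat:
  fixes G :: "nat monoid"
  assumes "functorial \<gamma>" "group G" "finite (carrier G)"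
  shows "radical \<gamma> G = \<gamma> G"
  using radical_iso[OF assms assms(2), of id] iso_set_refl[of G] by (simp add: id_def)

text \<open>\<open>\<gamma>\<^sub>(\<^sub>i\<^sub>+\<^sub>1\<^sub>)(G)\<close> is the preimage of \<open>\<gamma>(G / \<gamma>\<^sub>(\<^sub>i\<^sub>)(G))\<close> under the canonical projection.\<close>

primrec gamma_series :: "group_function \<Rightarrow> ('a, 'b) monoid_scheme \<Rightarrow> nat \<Rightarrow> 'a set" where
  "gamma_series \<gamma> G 0 = {\<one>\<^bsub>G\<^esub>}"
| "gamma_series \<gamma> G (Suc i) =
     {x \<in> carrier G. gamma_series \<gamma> G i #>\<^bsub>G\<^esub> x \<in> radical \<gamma> (G Mod gamma_series \<gamma> G i)}"

definition gamma_length :: "group_function \<Rightarrow> ('a, 'b) monoid_scheme \<Rightarrow> enat" where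
  "gamma_length \<gamma> G =
     (if \<exists>h. gamma_series \<gamma> G h = carrier G
      then enat (LEAST h. gamma_series \<gamma> G h = carrier G) else \<infinity>)"

end

theory Submission
  imports Defs
begin

text \<open>Write \<open>R\<^sub>i\<close> for \<open>\<gamma>\<^sub>(\<^sub>i\<^sub>)(G)\<close> and choose \<open>i\<close> with \<open>R\<^sub>i \<le> M\<close> but \<open>R\<^sub>i\<^sub>+\<^sub>1\<close> not contained in \<open>M\<close>, so that \<open>M\<close> maps
  onto \<open>G / R\<^sub>i\<^sub>+\<^sub>1\<close>. If \<open>i = k + 1\<close>, then heredity gives \<open>\<gamma>\<^sub>(\<^sub>k\<^sub>)(M) \<inter> R\<^sub>k\<^sub>+\<^sub>1 = R\<^sub>k\<close>, so \<open>\<gamma>\<^sub>(\<^sub>k\<^sub>)(M)\<close>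
  centralizes \<open>R\<^sub>k\<^sub>+\<^sub>1 / R\<^sub>k = \<gamma>(G / R\<^sub>k)\<close>. Since \<open>\<gamma>(H)\<close> contains its centralizer in any \<open>H\<close> of
  finite \<open>\<gamma>\<close>-length, \<open>\<gamma>\<^sub>(\<^sub>k\<^sub>)(M) \<le> R\<^sub>k\<close>; hence \<open>G / R\<^sub>k\<^sub>+\<^sub>2\<close> has length at most \<open>h\<^sub>\<gamma>(M) - k\<close>.\<close>

section \<open>Transport to groups of natural numbers, quotients and epimorphisms\<close>

lemma iso_to_nat_group:
  fixes G :: "('a, 'b) monoid_scheme"
  assumes "group G" "finite (carrier G)"
  obtains H :: "nat monoid" and f where "group H" "finite (carrier H)" "f \<in> iso G H"
proof -
  obtain f :: "'a \<Rightarrow> nat" where inj: "inj_on f (carrier G)"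
    using assms(2) finite_imp_inj_to_nat_seg by blast
  \<comment> \<open>For the trivial subgroup, being a weak morphism amounts to injectivity on the
    carrier. It lets \<open>image_group\<close> carry the multiplication of \<open>G\<close> over to
    the image of \<open>f\<close>.\<close>
  have "weak_group_morphism f {\<one>\<^bsub>G\<^esub>} G"
  proof (rule weak_group_morphismsI[OF group.one_is_normal[OF assms(1)]])
    fix a b assume "a \<in> carrier G" "b \<in> carrier G"
    then show "f a = f b \<longleftrightarrow> a \<otimes>\<^bsub>G\<^esub> inv\<^bsub>G\<^esub> b \<in> {\<one>\<^bsub>G\<^esub>}"
      using inj assms(1) by (metis inj_on_eq_iff group.inv_closed group.inv_equality
          group.inv_inv group.r_inv singleton_iff)
  qed
  then have hom: "group_hom G (image_group f G) f"
    by (rule group.weak_group_morphism_group_hom[OF assms(1)])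
  then have "f \<in> iso G (image_group f G)"
    using inj unfolding group_hom_def group_hom_axioms_def
    by (simp add: iso_def bij_betw_def image_group_carrier)
  then show thesis
    using that hom assms(2) by (metis finite_imageI group_hom.axioms(2) image_group_carrier)
qed

lemma normal_subset_restrict:
  assumes "group G" "N \<lhd> G" "subgroup K G" "N \<subseteq> K"
  shows "N \<lhd> G\<lparr>carrier := K\<rparr>"
proof -
  have "group (G\<lparr>carrier := K\<rparr>)"
    using assms by (simp add: group.subgroup_imp_group)
  moreover have "subgroup N (G\<lparr>carrier := K\<rparr>)"
    using assms by (simp add: group.subgroup_incl normal_imp_subgroup)
  moreover have "x \<otimes>\<^bsub>G\<^esub> h \<otimes>\<^bsub>G\<^esub> inv\<^bsub>G\<lparr>carrier := K\<rparr>\<^esub> x \<in> N" if "x \<in> K" "h \<in> N" for x h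
    using that assms by (simp add: group.m_inv_consistent normal.inv_op_closed2 subgroup.mem_carrier)
  ultimately show ?thesis
    by (simp add: group.normal_inv_iff)
qed

lemma normal_vimage:
  assumes "group G" "group H" "f \<in> hom G H" "S \<lhd> H"
  shows "{x \<in> carrier G. f x \<in> S} \<lhd> G"
proof -
  interpret f: group_hom G H f
    using assms by (simp add: group_hom_def group_hom_axioms_def)
  interpret S: normal S H by fact
  have "subgroup {x \<in> carrier G. f x \<in> S} G"
    by (rule subgroup.intro) auto
  then show ?thesis
    using S.inv_op_closed2 by (auto simp: f.G.normal_inv_iff)
qed

lemma Mod_epi: "N \<lhd> G \<Longrightarrow> (#>\<^bsub>G\<^esub>) N \<in> epi G (G Mod N)"
  using normal.r_coset_hom_Mod[of N G] by (simp add: epi_def carrier_FactGroup)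

lemma r_coset_eq_iff:
  assumes "N \<lhd> G" "x \<in> carrier G"
  shows "N #>\<^bsub>G\<^esub> x = N \<longleftrightarrow> x \<in> N"
  using assms group.coset_join1 group.coset_join2 normal.axioms(2) normal_imp_subgroup by metis

lemma kernel_Mod:
  assumes "N \<lhd> G"
  shows "kernel G (G Mod N) ((#>\<^bsub>G\<^esub>) N) = N"
  using r_coset_eq_iff[OF assms] normal_imp_subgroup[OF assms] subgroup.mem_carrier
  by (fastforce simp: kernel_def)

lemma finite_Mod: "finite (carrier G) \<Longrightarrow> finite (carrier (G Mod N))"
  by (simp add: carrier_FactGroup)

lemma finite_epi:
  assumes "f \<in> epi G H" "finite (carrier G)"
  shows "finite (carrier H)"
proof -
  have "carrier H = f ` carrier G"
    using assms(1) by (simp add: epi_def)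
  then show ?thesis
    using assms(2) by simp
qed

lemma epi_comp:
  assumes "f \<in> epi G H" "g \<in> epi H K"
  shows "(\<lambda>x. g (f x)) \<in> epi G K"
proof -
  have "(\<lambda>x. g (f x)) ` carrier G = carrier K"
    using assms by (simp add: epi_def flip: image_image)
  moreover have "g \<circ> f \<in> hom G K"
    using assms Group.hom_compose unfolding epi_def by blast
  ultimately show ?thesis
    by (simp add: epi_def comp_def)
qed

lemma epi_Mod_lift:
  assumes "group G" "group H" "f \<in> epi G H" "N \<lhd> G" "N \<subseteq> kernel G H f"
  obtains g where "g \<in> epi (G Mod N) H" "\<And>x. x \<in> carrier G \<Longrightarrow> g (N #>\<^bsub>G\<^esub> x) = f x"
proof -
  interpret f: group_hom G H f
    using assms by (simp add: group_hom_def group_hom_axioms_def epi_def)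
  obtain g where g: "g \<in> hom (G Mod N) H" "\<And>x. x \<in> carrier G \<Longrightarrow> g (N #>\<^bsub>G\<^esub> x) = f x"
    using f.FactGroup_universal_kernel[OF assms(4,5)] by blast
  moreover have "g ` carrier (G Mod N) = carrier H"
    using g(2) assms(3) by (simp add: carrier_FactGroup image_image epi_def)
  ultimately show thesis
    using that by (simp add: epi_def)
qed

lemma epi_Mod_kernel_iso:
  assumes "group G" "group H" "f \<in> epi G H"
  obtains g where "g \<in> iso (G Mod kernel G H f) H"
    "\<And>x. x \<in> carrier G \<Longrightarrow> g (kernel G H f #>\<^bsub>G\<^esub> x) = f x"
proof -
  interpret f: group_hom G H f
    using assms by (simp add: group_hom_def group_hom_axioms_def epi_def)
  \<comment> \<open>The isomorphism of \<open>FactGroup_iso_set\<close> sends a coset to the only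
    element of its image under \<open>f\<close>, so evaluating it requires this image to be a
    singleton.\<close>
  have "f ` (kernel G H f #>\<^bsub>G\<^esub> x) = {f x}" if "x \<in> carrier G" for x
    using that f.one_closed f.hom_one by (force simp: kernel_def r_coset_def)
  then show thesis
    using that f.FactGroup_iso_set assms(3) by (simp add: epi_def)
qed

lemma iso_imp_epi: "f \<in> iso G H \<Longrightarrow> f \<in> epi G H"
  by (simp add: iso_def epi_def bij_betw_def)

lemma conjugation_iso:
  assumes "group G" "g \<in> carrier G"
  shows "(\<lambda>x. g \<otimes>\<^bsub>G\<^esub> x \<otimes>\<^bsub>G\<^esub> inv\<^bsub>G\<^esub> g) \<in> iso G G"
proof -
  interpret group G by fact
  have "bij_betw (\<lambda>x\<in>carrier G. g \<otimes>\<^bsub>G\<^esub> x \<otimes>\<^bsub>G\<^esub> inv\<^bsub>G\<^esub> g) (carrier G) (carrier G)"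
    using conjugation_is_bij[OF assms(2)] .
  then have "bij_betw (\<lambda>x. g \<otimes>\<^bsub>G\<^esub> x \<otimes>\<^bsub>G\<^esub> inv\<^bsub>G\<^esub> g) (carrier G) (carrier G)"
    by (rule bij_betw_cong[THEN iffD1, rotated]) simp
  moreover have "g \<otimes>\<^bsub>G\<^esub> (x \<otimes>\<^bsub>G\<^esub> y) \<otimes>\<^bsub>G\<^esub> inv\<^bsub>G\<^esub> g =
      g \<otimes>\<^bsub>G\<^esub> x \<otimes>\<^bsub>G\<^esub> inv\<^bsub>G\<^esub> g \<otimes>\<^bsub>G\<^esub> (g \<otimes>\<^bsub>G\<^esub> y \<otimes>\<^bsub>G\<^esub> inv\<^bsub>G\<^esub> g)"
    if "x \<in> carrier G" "y \<in> carrier G" for x y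
  proof -
    have "inv\<^bsub>G\<^esub> g \<otimes>\<^bsub>G\<^esub> (g \<otimes>\<^bsub>G\<^esub> (y \<otimes>\<^bsub>G\<^esub> inv\<^bsub>G\<^esub> g)) = y \<otimes>\<^bsub>G\<^esub> inv\<^bsub>G\<^esub> g"
      using that assms by (simp add: m_assoc[symmetric])
    then show ?thesis
      using that assms by (simp add: m_assoc)
  qed
  ultimately show ?thesis
    using assms(2) by (simp add: iso_def hom_def)
qed

section \<open>The radical on finite groups over arbitrary types\<close>

locale plotkin_radical =
  fixes \<gamma> :: group_function
  assumes hereditary: "hereditary_Plotkin_radical \<gamma>"
begin

lemma functorial: "functorial \<gamma>"
  using hereditary by (simp add: hereditary_Plotkin_radical_def)

lemma radical_eq:
  fixes G :: "('a, 'b) monoid_scheme" and H :: "nat monoid"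
  assumes "group G" "finite (carrier G)" "group H" "f \<in> iso G H"
  shows "radical \<gamma> G = {x \<in> carrier G. f x \<in> \<gamma> H}"
  using radical_iso[OF functorial assms] assms(3,4) by (auto simp: radical_def)

lemma radical_subset: "radical \<gamma> G \<subseteq> carrier G"
  by (auto simp: radical_def)

lemma subgroup_nat:
  fixes H :: "nat monoid"
  shows "group H \<Longrightarrow> finite (carrier H) \<Longrightarrow> subgroup (\<gamma> H) H"
  using functorial by (simp add: functorial_def)

text \<open>Condition (P1) is assumed for groups of natural numbers only; composing \<open>f\<close>
  with isomorphisms from and to such groups extends it. Independent element types for
  \<open>G\<close> and \<open>H\<close> are needed because quotients have cosets as
  elements.\<close>

lemma radical_epi:
  fixes G :: "('a, 'b) monoid_scheme" and H :: "('c, 'd) monoid_scheme"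
  assumes G: "group G" "finite (carrier G)" and H: "group H"
    and f: "f \<in> epi G H" and x: "x \<in> radical \<gamma> G"
  shows "f x \<in> radical \<gamma> H"
proof -
  obtain G' :: "nat monoid" and g where g: "group G'" "finite (carrier G')" "g \<in> iso G G'"
    using iso_to_nat_group G by blast
  obtain H' :: "nat monoid" and h where h: "group H'" "finite (carrier H')" "h \<in> iso H H'"
    using iso_to_nat_group H finite_epi[OF f G(2)] by blast
  let ?k = "\<lambda>y. h (f (inv_into (carrier G) g y))"
  have "inv_into (carrier G) g \<in> iso G' G"
    using group.iso_set_sym[OF G(1) g(3)] .
  then have "?k \<in> epi G' H'"
    using epi_comp[OF epi_comp[OF iso_imp_epi f] iso_imp_epi[OF h(3)]] by blast
  then have "?k ` \<gamma> G' \<subseteq> \<gamma> H'"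
    using hereditary g h by (simp add: hereditary_Plotkin_radical_def)
  moreover have "g x \<in> \<gamma> G'" and xG: "x \<in> carrier G"
    using x radical_eq[OF G g(1,3)] by auto
  moreover have "inv_into (carrier G) g (g x) = x"
    using g(3) xG by (simp add: iso_def bij_betw_def)
  ultimately have "h (f x) \<in> \<gamma> H'"
    by (metis image_subset_iff)
  moreover have "f x \<in> carrier H"
    using f xG by (auto simp: epi_def)
  ultimately show ?thesis
    using radical_eq[OF H finite_epi[OF f G(2)] h(1,3)] by simp
qed

lemma radical_iso_iff:
  fixes G :: "('a, 'b) monoid_scheme" and H :: "('c, 'd) monoid_scheme"
  assumes "group G" "finite (carrier G)" "group H" "f \<in> iso G H" "x \<in> carrier G"
  shows "f x \<in> radical \<gamma> H \<longleftrightarrow> x \<in> radical \<gamma> G"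
proof
  assume "x \<in> radical \<gamma> G"
  then show "f x \<in> radical \<gamma> H"
    by (rule radical_epi[OF assms(1-3) iso_imp_epi[OF assms(4)]])
next
  have fin: "finite (carrier H)"
    using finite_epi[OF iso_imp_epi[OF assms(4)] assms(2)] .
  have inv: "inv_into (carrier G) f \<in> iso H G"
    using group.iso_set_sym[OF assms(1,4)] .
  assume "f x \<in> radical \<gamma> H"
  from radical_epi[OF assms(3) fin assms(1) iso_imp_epi[OF inv] this]
  show "x \<in> radical \<gamma> G"
    using assms(4,5) by (simp add: iso_def bij_betw_def)
qed

lemma radical_normal:
  fixes G :: "('a, 'b) monoid_scheme"
  assumes G: "group G" "finite (carrier G)"
  shows "radical \<gamma> G \<lhd> G"
proof -
  obtain G' :: "nat monoid" and g where g: "group G'" "finite (carrier G')" "g \<in> iso G G'"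
    using iso_to_nat_group G by blast
  interpret g: group_hom G G' g
    using g G by (simp add: group_hom_def group_hom_axioms_def iso_def)
  interpret S: subgroup "\<gamma> G'" G'
    using subgroup_nat g by simp
  have "subgroup (radical \<gamma> G) G"
    unfolding radical_eq[OF G g(1,3)] by (rule subgroup.intro) auto
  \<comment> \<open>The radical is invariant under automorphisms, and conjugation is one.\<close>
  moreover have "y \<otimes>\<^bsub>G\<^esub> x \<otimes>\<^bsub>G\<^esub> inv\<^bsub>G\<^esub> y \<in> radical \<gamma> G" if "y \<in> carrier G" "x \<in> radical \<gamma> G" for x y
    using radical_iso_iff[OF G G(1) conjugation_iso[OF G(1) that(1)], of x] that(2) radical_subset by (metis subsetD)
  ultimately show ?thesis
    using group.normal_inv_iff[OF G(1)] by blast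
qed

text \<open>An isomorphism \<open>g\<close> onto a group of natural numbers restricts to one on
  \<open>N\<close>, so both radicals are read off through the same map, and (P2) compares them on
  the side of the natural numbers.\<close>

lemma radical_Int_normal:
  fixes G :: "('a, 'b) monoid_scheme"
  assumes G: "group G" "finite (carrier G)" and N: "N \<lhd> G"
  shows "radical \<gamma> G \<inter> N = radical \<gamma> (G\<lparr>carrier := N\<rparr>)"
proof -
  obtain G' :: "nat monoid" and g where g: "group G'" "finite (carrier G')" "g \<in> iso G G'"
    using iso_to_nat_group G by blast
  have sub: "subgroup N G"
    using N by (rule normal_imp_subgroup)
  have N': "g ` N \<lhd> G'"
    using iso_normal_subgroup g G N by blast
  have gN: "g \<in> iso (G\<lparr>carrier := N\<rparr>) (G'\<lparr>carrier := g ` N\<rparr>)"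
    using g(3) subgroup.subset[OF sub] 
    by (auto simp: iso_def hom_def bij_betw_def subset_iff intro: inj_on_subset)
  have "radical \<gamma> (G\<lparr>carrier := N\<rparr>) = {x \<in> N. g x \<in> \<gamma> (G'\<lparr>carrier := g ` N\<rparr>)}"
    using radical_eq[OF group.subgroup_imp_group[OF G(1) sub] _
        group.subgroup_imp_group[OF g(1) normal_imp_subgroup[OF N']] gN]
      finite_subset[OF subgroup.subset[OF sub] G(2)] by simp
  also have "\<dots> = {x \<in> N. g x \<in> \<gamma> G'}"
  proof -
    have "\<gamma> G' \<inter> g ` N = \<gamma> (G'\<lparr>carrier := g ` N\<rparr>)"
      using hereditary g(1,2) N' by (simp add: hereditary_Plotkin_radical_def)
    then show ?thesis by blast
  qed
  also have "\<dots> = radical \<gamma> G \<inter> N"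
    using radical_eq[OF G g(1,3)] subgroup.subset[OF sub] by blast
  finally show ?thesis ..
qed

text \<open>Lets any epimorphism with the right kernel play the role of the canonical projection in the
  \<open>\<gamma>\<close>-series.\<close>

lemma radical_Mod_kernel_iff:
  fixes G :: "('a, 'b) monoid_scheme" and H :: "('c, 'd) monoid_scheme"
  assumes G: "group G" "finite (carrier G)" and H: "group H" and f: "f \<in> epi G H"
    and x: "x \<in> carrier G"
  shows "kernel G H f #>\<^bsub>G\<^esub> x \<in> radical \<gamma> (G Mod kernel G H f) \<longleftrightarrow> f x \<in> radical \<gamma> H"
proof -
  interpret f: group_hom G H f
    using assms by (simp add: group_hom_def group_hom_axioms_def epi_def)
  obtain g where g: "g \<in> iso (G Mod kernel G H f) H" "g (kernel G H f #>\<^bsub>G\<^esub> x) = f x"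
    using epi_Mod_kernel_iso[OF G(1) H f] x by metis
  then show ?thesis
    using radical_iso_iff[OF _ _ H g(1)] x f.normal_kernel
    by (metis G(2) carrier_FactGroup finite_Mod imageI normal.factorgroup_is_group)
qed

section \<open>The \<gamma>-series under epimorphisms and in normal subgroups\<close>

lemma gamma_series_normal:
  assumes "group G" "finite (carrier G)"
  shows "gamma_series \<gamma> G i \<lhd> G"
proof (induction i)
  case 0
  then show ?case by (simp add: group.one_is_normal assms)
next
  case (Suc i)
  have "radical \<gamma> (G Mod gamma_series \<gamma> G i) \<lhd> G Mod gamma_series \<gamma> G i"
    by (intro radical_normal normal.factorgroup_is_group Suc finite_Mod assms)
  then show ?case
    using normal_vimage[OF assms(1) normal.factorgroup_is_group[OF Suc] normal.r_coset_hom_Mod[OF Suc]]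
    by simp
qed

lemma gamma_series_subset:
  assumes "group G" "finite (carrier G)"
  shows "gamma_series \<gamma> G i \<subseteq> carrier G"
  using gamma_series_normal[OF assms] normal_imp_subgroup subgroup.subset by blast

lemma gamma_series_Suc_iff:
  assumes "group G" "finite (carrier G)" "group H" "f \<in> epi G H"
    and "kernel G H f = gamma_series \<gamma> G i" "x \<in> carrier G"
  shows "x \<in> gamma_series \<gamma> G (Suc i) \<longleftrightarrow> f x \<in> radical \<gamma> H"
  using radical_Mod_kernel_iff[OF assms(1-4,6)] assms(5,6) by simp

lemma gamma_series_mono:
  assumes G: "group G" "finite (carrier G)" and "i \<le> j"
  shows "gamma_series \<gamma> G i \<subseteq> gamma_series \<gamma> G j"
proof -
  have "gamma_series \<gamma> G i \<subseteq> gamma_series \<gamma> G (Suc i)" for i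
  proof
    fix x assume x: "x \<in> gamma_series \<gamma> G i"
    have N: "gamma_series \<gamma> G i \<lhd> G"
      using gamma_series_normal G by blast
    have xG: "x \<in> carrier G"
      using x gamma_series_subset G by blast
    have "subgroup (radical \<gamma> (G Mod gamma_series \<gamma> G i)) (G Mod gamma_series \<gamma> G i)"
      by (intro normal_imp_subgroup radical_normal normal.factorgroup_is_group N finite_Mod G)
    then show "x \<in> gamma_series \<gamma> G (Suc i)"
      using subgroup.one_closed xG x r_coset_eq_iff[OF N xG] by fastforce
  qed
  then show ?thesis
    using \<open>i \<le> j\<close> by (rule lift_Suc_mono_le)
qed

text \<open>By induction on \<open>j\<close>, \<open>f\<close> descends to an epimorphism between
  the quotients by \<open>gamma_series \<gamma> G (k + j)\<close> and
  \<open>gamma_series \<gamma> H j\<close>, to which (P1) applies. The shift counts the terms that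
  \<open>f\<close> kills; it later saves \<open>k\<close> steps of the series of the maximal
  subgroup.\<close>

lemma gamma_series_epi:
  fixes G :: "('a, 'b) monoid_scheme" and H :: "('c, 'd) monoid_scheme"
  assumes G: "group G" "finite (carrier G)" and H: "group H" and f: "f \<in> epi G H"
    and k: "gamma_series \<gamma> G k \<subseteq> kernel G H f"
  shows "f ` gamma_series \<gamma> G (k + j) \<subseteq> gamma_series \<gamma> H j"
proof (induction j)
  case 0
  then show ?case using k by (auto simp: kernel_def)
next
  case (Suc j)
  let ?N = "gamma_series \<gamma> G (k + j)" and ?K = "gamma_series \<gamma> H j"
  have fH: "f x \<in> carrier H" if "x \<in> carrier G" for x
    using f that by (auto simp: epi_def)
  have N: "?N \<lhd> G" and K: "?K \<lhd> H"
    using gamma_series_normal G H finite_epi[OF f] by blast+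
  let ?h = "\<lambda>x. ?K #>\<^bsub>H\<^esub> f x"
  have h: "?h \<in> epi G (H Mod ?K)"
    using epi_comp[OF f Mod_epi[OF K]] .
  have "?N \<subseteq> kernel G (H Mod ?K) ?h"
  proof
    fix x assume x: "x \<in> ?N"
    then have "x \<in> carrier G" "f x \<in> ?K"
      using gamma_series_subset[OF G] Suc by auto
    then show "x \<in> kernel G (H Mod ?K) ?h"
      using r_coset_eq_iff[OF K] fH by (simp add: kernel_def)
  qed
  then obtain g where g: "g \<in> epi (G Mod ?N) (H Mod ?K)"
      "\<And>x. x \<in> carrier G \<Longrightarrow> g (?N #>\<^bsub>G\<^esub> x) = ?h x"
    using epi_Mod_lift[OF G(1) normal.factorgroup_is_group[OF K] h N] by blast
  show ?case
  proof clarify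
    fix x assume "x \<in> gamma_series \<gamma> G (k + Suc j)"
    then have x: "x \<in> carrier G" "?N #>\<^bsub>G\<^esub> x \<in> radical \<gamma> (G Mod ?N)"
      by auto
    then have "?h x \<in> radical \<gamma> (H Mod ?K)"
      using radical_epi[OF normal.factorgroup_is_group[OF N] finite_Mod[OF G(2)]
          normal.factorgroup_is_group[OF K] g(1) x(2)] g(2)[OF x(1)] by simp
    then show "f x \<in> gamma_series \<gamma> H (Suc j)"
      using fH[OF x(1)] by simp
  qed
qed

text \<open>By the induction hypothesis, the projection \<open>?p\<close> restricted to
  \<open>N\<close> has the \<open>i\<close>-th term of the series of \<open>N\<close> as its kernel.
  Its image is normal in \<open>?Q\<close>, so (P2) in \<open>?Q\<close> compares the next
  terms.\<close>

lemma gamma_series_Int_normal: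
  assumes G: "group G" "finite (carrier G)" and N: "N \<lhd> G"
  shows "gamma_series \<gamma> G i \<inter> N = gamma_series \<gamma> (G\<lparr>carrier := N\<rparr>) i"
proof (induction i)
  case 0
  then show ?case
    using normal_imp_subgroup[OF N] subgroup.one_closed by auto
next
  case (Suc i)
  let ?A = "gamma_series \<gamma> G i"
  let ?Q = "G Mod ?A" and ?p = "(#>\<^bsub>G\<^esub>) ?A" and ?N = "G\<lparr>carrier := N\<rparr>"
  have A: "?A \<lhd> G"
    using gamma_series_normal G by blast
  have sub: "subgroup N G" and NG: "N \<subseteq> carrier G"
    using N normal_imp_subgroup subgroup.subset by blast+
  have p: "?p \<in> epi G ?Q"
    using Mod_epi[OF A] .
  have Q: "group ?Q" "finite (carrier ?Q)"
    using normal.factorgroup_is_group[OF A] finite_Mod[OF G(2)] by blast+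
  have I: "?p ` N \<lhd> ?Q"
    using normal.surj_hom_normal_subgroup[OF N, of ?Q ?p] p G Q
    by (simp add: epi_def group_hom_def group_hom_axioms_def)
  have pN: "?p \<in> epi ?N (?Q\<lparr>carrier := ?p ` N\<rparr>)"
    using p NG by (simp add: epi_def hom_def subset_iff Pi_iff)
  have ker: "kernel ?N (?Q\<lparr>carrier := ?p ` N\<rparr>) ?p = gamma_series \<gamma> ?N i"
    using Suc r_coset_eq_iff[OF A] NG by (auto simp: kernel_def)
  have "x \<in> gamma_series \<gamma> ?N (Suc i) \<longleftrightarrow> x \<in> gamma_series \<gamma> G (Suc i)" if x: "x \<in> N" for x
  proof -
    have "x \<in> gamma_series \<gamma> ?N (Suc i) \<longleftrightarrow> ?p x \<in> radical \<gamma> (?Q\<lparr>carrier := ?p ` N\<rparr>)"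
      using x NG finite_subset[OF NG G(2)] group.subgroup_imp_group[OF G(1) sub]
        group.subgroup_imp_group[OF Q(1) normal_imp_subgroup[OF I]]
      by (intro gamma_series_Suc_iff[OF _ _ _ pN ker]) auto
    also have "\<dots> \<longleftrightarrow> ?p x \<in> radical \<gamma> ?Q"
      using radical_Int_normal[OF Q I] x by blast
    finally show ?thesis
      using x NG by auto
  qed
  moreover have "gamma_series \<gamma> ?N (Suc i) \<subseteq> N"
    by auto
  ultimately show ?case
    by blast
qed

text \<open>In the spirit of the third isomorphism theorem, \<open>f\<close> followed by the
  projection modulo \<open>gamma_series \<gamma> H j\<close> has kernel exactly
  \<open>gamma_series \<gamma> G (k + j)\<close>, by induction. Since the kernel of \<open>f\<close>
  is itself a term of the series, membership also lifts back from \<open>H\<close> to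
  \<open>G\<close>, which \<open>gamma_series_epi\<close> cannot give.\<close>

lemma gamma_series_add_iff:
  fixes G :: "('a, 'b) monoid_scheme" and H :: "('c, 'd) monoid_scheme"
  assumes G: "group G" "finite (carrier G)" and H: "group H" and f: "f \<in> epi G H"
    and k: "kernel G H f = gamma_series \<gamma> G k" and x: "x \<in> carrier G"
  shows "x \<in> gamma_series \<gamma> G (k + j) \<longleftrightarrow> f x \<in> gamma_series \<gamma> H j"
  using x
proof (induction j arbitrary: x)
  case 0
  then show ?case using k by (auto simp: kernel_def)
next
  case (Suc j)
  let ?K = "gamma_series \<gamma> H j"
  let ?h = "\<lambda>x. ?K #>\<^bsub>H\<^esub> f x"
  have K: "?K \<lhd> H"
    using gamma_series_normal H finite_epi[OF f] G by blast
  have h: "?h \<in> epi G (H Mod ?K)"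
    using epi_comp[OF f Mod_epi[OF K]] .
  have "f x \<in> carrier H" if "x \<in> carrier G" for x
    using f that by (auto simp: epi_def)
  then have "kernel G (H Mod ?K) ?h = {x \<in> carrier G. x \<in> gamma_series \<gamma> G (k + j)}"
    using Suc.IH r_coset_eq_iff[OF K] by (simp add: kernel_def cong: conj_cong)
  then have "kernel G (H Mod ?K) ?h = gamma_series \<gamma> G (k + j)"
    using gamma_series_subset[OF G, of "k + j"] by blast
  then show ?case
    using gamma_series_Suc_iff[OF G normal.factorgroup_is_group[OF K] h] Suc.prems f
    by (auto simp: epi_def)
qed


section \<open>Finite \<gamma>-length for epimorphic images and normal subgroups\<close>

lemma gamma_length_finite_iff:
  "gamma_length \<gamma> G < \<infinity> \<longleftrightarrow> (\<exists>h. gamma_series \<gamma> G h = carrier G)"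
  by (simp add: gamma_length_def)

lemma gamma_length_finite_epi:
  assumes "group G" "finite (carrier G)" "group H" "f \<in> epi G H" "gamma_length \<gamma> G < \<infinity>"
  shows "gamma_length \<gamma> H < \<infinity>"
proof -
  obtain h where h: "gamma_series \<gamma> G h = carrier G"
    using gamma_length_finite_iff[THEN iffD1, OF assms(5)] by blast
  have "f \<one>\<^bsub>G\<^esub> = \<one>\<^bsub>H\<^esub>"
    using assms by (auto simp: epi_def intro: hom_one)
  \<comment> \<open>With \<open>k = 0\<close>, the kernel condition of
    \<open>gamma_series_epi\<close> holds for every epimorphism.\<close>
  then have "gamma_series \<gamma> G 0 \<subseteq> kernel G H f"
    using assms(1) by (simp add: kernel_def group.is_monoid monoid.one_closed)
  from gamma_series_epi[OF assms(1-4) this, of h] have "carrier H \<subseteq> gamma_series \<gamma> H h"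
    using h assms(4) by (simp add: epi_def)
  then show ?thesis
    using gamma_series_subset[OF assms(3) finite_epi[OF assms(4,2)], of h]
    by (intro gamma_length_finite_iff[THEN iffD2] exI[of _ h]) simp
qed

lemma gamma_length_finite_normal:
  assumes "group G" "finite (carrier G)" "N \<lhd> G" "gamma_length \<gamma> G < \<infinity>"
  shows "gamma_length \<gamma> (G\<lparr>carrier := N\<rparr>) < \<infinity>"
proof -
  obtain h where "gamma_series \<gamma> G h = carrier G"
    using gamma_length_finite_iff[THEN iffD1, OF assms(4)] by blast
  then have "gamma_series \<gamma> (G\<lparr>carrier := N\<rparr>) h = carrier (G\<lparr>carrier := N\<rparr>)"
    using gamma_series_Int_normal[OF assms(1-3), of h] normal_imp_subgroup[OF assms(3)]
      subgroup.subset by fastforce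
  then show ?thesis
    by (intro gamma_length_finite_iff[THEN iffD2] exI[of _ h])
qed

end

section \<open>Centralizers, nilpotent and quasisimple groups\<close>

lemma centralizer_normal:
  assumes "A \<lhd> G"
  shows "{x \<in> carrier G. \<forall>y\<in>A. x \<otimes>\<^bsub>G\<^esub> y = y \<otimes>\<^bsub>G\<^esub> x} \<lhd> G" (is "?C \<lhd> G")
proof -
  interpret A: normal A G by fact
  have AG: "y \<in> carrier G" if "y \<in> A" for y
    using that A.subset by blast
  have sub: "subgroup ?C G"
  proof (rule subgroup.intro)
    fix x y assume xy: "x \<in> ?C" "y \<in> ?C"
    have "x \<otimes>\<^bsub>G\<^esub> y \<otimes>\<^bsub>G\<^esub> z = z \<otimes>\<^bsub>G\<^esub> (x \<otimes>\<^bsub>G\<^esub> y)" if z: "z \<in> A" for z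
    proof -
      have "x \<otimes>\<^bsub>G\<^esub> y \<otimes>\<^bsub>G\<^esub> z = x \<otimes>\<^bsub>G\<^esub> (z \<otimes>\<^bsub>G\<^esub> y)"
        using xy z AG by (simp add: A.m_assoc)
      also have "\<dots> = z \<otimes>\<^bsub>G\<^esub> x \<otimes>\<^bsub>G\<^esub> y"
        using xy z AG by (simp flip: A.m_assoc)
      finally show ?thesis
        using xy z AG by (simp add: A.m_assoc)
    qed
    then show "x \<otimes>\<^bsub>G\<^esub> y \<in> ?C"
      using xy by simp
  next
    fix x assume x: "x \<in> ?C"
    have "inv\<^bsub>G\<^esub> x \<otimes>\<^bsub>G\<^esub> y = y \<otimes>\<^bsub>G\<^esub> inv\<^bsub>G\<^esub> x" if y: "y \<in> A" for y
    proof -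
      have "x \<in> carrier G" "x \<otimes>\<^bsub>G\<^esub> y = y \<otimes>\<^bsub>G\<^esub> x"
        using x y by auto
      then show ?thesis
        using AG[OF y] by (metis A.inv_closed A.inv_solve_left A.inv_solve_right A.m_assoc A.m_closed)
    qed
    then show "inv\<^bsub>G\<^esub> x \<in> ?C"
      using x by simp
  qed (use AG in auto)
  have "g \<otimes>\<^bsub>G\<^esub> x \<otimes>\<^bsub>G\<^esub> inv\<^bsub>G\<^esub> g \<in> ?C" if g: "g \<in> carrier G" and x: "x \<in> ?C" for g x
  proof -
    have "g \<otimes>\<^bsub>G\<^esub> x \<otimes>\<^bsub>G\<^esub> inv\<^bsub>G\<^esub> g \<otimes>\<^bsub>G\<^esub> y = y \<otimes>\<^bsub>G\<^esub> (g \<otimes>\<^bsub>G\<^esub> x \<otimes>\<^bsub>G\<^esub> inv\<^bsub>G\<^esub> g)"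
      if y: "y \<in> A" for y
    proof -
      \<comment> \<open>The element \<open>z\<close> has \<open>y\<close> as its conjugate by
        \<open>g\<close> and stays in \<open>A\<close> by normality, so \<open>x\<close> commutes
        with it; conjugating this relation by \<open>g\<close> gives the claim for
        \<open>y\<close>.\<close>
      define z where "z = inv\<^bsub>G\<^esub> g \<otimes>\<^bsub>G\<^esub> y \<otimes>\<^bsub>G\<^esub> g"
      have z: "z \<in> A" "z \<in> carrier G"
        using A.inv_op_closed1[OF g y] AG unfolding z_def by blast+
      have y_eq: "y = g \<otimes>\<^bsub>G\<^esub> z \<otimes>\<^bsub>G\<^esub> inv\<^bsub>G\<^esub> g"
        unfolding z_def using A.conjugation_is_surj[OF g AG[OF y]] by simp
      have conj: "g \<otimes>\<^bsub>G\<^esub> a \<otimes>\<^bsub>G\<^esub> inv\<^bsub>G\<^esub> g \<otimes>\<^bsub>G\<^esub> (g \<otimes>\<^bsub>G\<^esub> b \<otimes>\<^bsub>G\<^esub> inv\<^bsub>G\<^esub> g) =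
          g \<otimes>\<^bsub>G\<^esub> (a \<otimes>\<^bsub>G\<^esub> b) \<otimes>\<^bsub>G\<^esub> inv\<^bsub>G\<^esub> g" if "a \<in> carrier G" "b \<in> carrier G" for a b
        using conjugation_iso[OF A.is_group g] that by (simp add: iso_def hom_def)
      have "x \<in> carrier G" "x \<otimes>\<^bsub>G\<^esub> z = z \<otimes>\<^bsub>G\<^esub> x"
        using x z by auto
      then show ?thesis
        unfolding y_eq using conj z by simp
    qed
    then show ?thesis
      using g x by simp
  qed
  then show ?thesis
    using sub A.normal_inv_iff by blast
qed

lemma centre_normal:
  assumes "group G"
  shows "centre G \<lhd> G"
  using centralizer_normal[OF group.normal_self[OF assms]] by (simp add: centre_def)

text \<open>Commutators with a central entry are trivial, so the lower central series is trivial at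
  index 2. Its indexing starts with the whole group at 0, hence index 1 is the derived
  subgroup.\<close>

lemma nilpotent_if_derived_central:
  assumes "group G" "derived G (carrier G) \<subseteq> centre G"
  shows "nilpotent_group G"
proof -
  interpret group G by fact
  have "lower_central G (Suc 0) = derived G (carrier G)"
    unfolding derived_def lower_central.simps by (rule arg_cong[where f = "generate G"]) blast
  then have sub: "lower_central G (Suc 0) \<subseteq> centre G"
    using assms(2) by simp
  have "x \<otimes>\<^bsub>G\<^esub> y \<otimes>\<^bsub>G\<^esub> inv\<^bsub>G\<^esub> x \<otimes>\<^bsub>G\<^esub> inv\<^bsub>G\<^esub> y = \<one>\<^bsub>G\<^esub>"
    if "x \<in> lower_central G (Suc 0)" "y \<in> carrier G" for x y
  proof -
    have "x \<in> carrier G" "x \<otimes>\<^bsub>G\<^esub> y = y \<otimes>\<^bsub>G\<^esub> x"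
      using sub that by (auto simp: centre_def)
    then show ?thesis
      using that(2) by (simp add: m_assoc)
  qed
  then have "lower_central G (Suc (Suc 0)) \<subseteq> generate G {\<one>\<^bsub>G\<^esub>}"
    unfolding lower_central.simps(2)[of G "Suc 0"] by (intro mono_generate) blast
  then have "lower_central G (Suc (Suc 0)) = {\<one>\<^bsub>G\<^esub>}"
    using generate_one generate.one unfolding lower_central.simps(2)[of G "Suc 0"] by blast
  then show ?thesis
    unfolding nilpotent_group_def using assms(1) by blast
qed

lemma gen_Fitting_nilpotent:
  assumes "nilpotent_group G"
  shows "carrier G \<subseteq> gen_Fitting G"
proof -
  interpret group G using assms by (simp add: nilpotent_group_def)
  have "carrier G \<subseteq> Fitting G"
    using assms normal_self unfolding Fitting_def
    by (intro subsetI generate.incl UnionI[of "carrier G"]) auto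
  moreover have "\<one>\<^bsub>G\<^esub> \<in> layer G"
    unfolding layer_def by (rule generate.one)
  ultimately show ?thesis
    unfolding gen_Fitting_def set_mult_def by (force intro: r_one[symmetric])
qed

lemma gen_Fitting_quasisimple:
  assumes "quasisimple_group G"
  shows "carrier G \<subseteq> gen_Fitting G"
proof -
  interpret group G using assms by (simp add: quasisimple_group_def)
  have "carrier G \<subseteq> layer G"
    using assms subnormal_carrier unfolding layer_def
    by (intro subsetI generate.incl UnionI[of "carrier G"]) auto
  moreover have "\<one>\<^bsub>G\<^esub> \<in> Fitting G"
    unfolding Fitting_def by (rule generate.one)
  ultimately show ?thesis
    unfolding gen_Fitting_def set_mult_def by (force intro: l_one[symmetric])
qed

text \<open>Normal subgroups of the central quotient pull back to normal subgroups of
  \<open>G\<close>. A proper one is central, so its image in the quotient is trivial.\<close>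

lemma quasisimpleI:
  assumes G: "group G" "finite (carrier G)" "derived G (carrier G) = carrier G"
    and Z: "centre G \<noteq> carrier G"
    and central: "\<And>N. N \<lhd> G \<Longrightarrow> N \<noteq> carrier G \<Longrightarrow> N \<subseteq> centre G"
  shows "quasisimple_group G"
proof -
  let ?Z = "centre G"
  have N: "?Z \<lhd> G"
    using centre_normal G by blast
  have Q: "group (G Mod ?Z)"
    using N by (rule normal.factorgroup_is_group)
  have ZG: "?Z \<subseteq> carrier G"
    by (auto simp: centre_def)
  obtain x where x: "x \<in> carrier G" "x \<notin> ?Z"
    using Z ZG by blast
  \<comment> \<open>\<open>simple_group\<close> demands order above 1: the centre and the coset of a
    noncentral element are two distinct elements of the quotient.\<close>
  have "?Z #>\<^bsub>G\<^esub> x \<noteq> ?Z"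
    using r_coset_eq_iff[OF N x(1)] x(2) by simp
  moreover have "{?Z, ?Z #>\<^bsub>G\<^esub> x} \<subseteq> carrier (G Mod ?Z)"
    using x(1) group.is_monoid[OF Q] monoid.one_closed[of "G Mod ?Z"] by (simp add: carrier_FactGroup)
  ultimately have "1 < order (G Mod ?Z)"
    unfolding order_def using card_mono[OF finite_Mod[OF G(2)], of "{?Z, ?Z #>\<^bsub>G\<^esub> x}" ?Z] by simp
  moreover have "K = carrier (G Mod ?Z) \<or> K = {\<one>\<^bsub>G Mod ?Z\<^esub>}" if K: "K \<lhd> G Mod ?Z" for K
  proof -
    let ?P = "{x \<in> carrier G. ?Z #>\<^bsub>G\<^esub> x \<in> K}"
    have P: "?P \<lhd> G"
      using normal_vimage[OF G(1) Q normal.r_coset_hom_Mod[OF N] K] .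
    have KQ: "K \<subseteq> carrier (G Mod ?Z)" and one: "\<one>\<^bsub>G Mod ?Z\<^esub> \<in> K"
      using normal_imp_subgroup[OF K] subgroup.subset subgroup.one_closed by blast+
    show ?thesis
    proof (cases "?P = carrier G")
      case True
      then show ?thesis
        using KQ by (auto simp: carrier_FactGroup)
    next
      case False
      have "y = ?Z" if y: "y \<in> K" for y
      proof -
        obtain x where "x \<in> carrier G" "y = ?Z #>\<^bsub>G\<^esub> x"
          using y KQ by (auto simp: carrier_FactGroup)
        then show ?thesis
          using central[OF P False] y r_coset_eq_iff[OF N] by blast
      qed
      then have "K \<subseteq> {?Z}"
        by blast
      then show ?thesis
        using one by (simp add: subset_singleton_iff) blast
    qed
  qed
  ultimately have "simple_group (G Mod ?Z)"
    using Q by (simp add: simple_group_def simple_group_axioms_def)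
  then show ?thesis
    using G by (simp add: quasisimple_group_def)
qed

section \<open>The radical contains its own centralizer\<close>

locale gen_Fitting_radical = plotkin_radical +
  assumes gen_Fitting_le: "group H \<Longrightarrow> finite (carrier H) \<Longrightarrow> gamma_length \<gamma> H < \<infinity> \<Longrightarrow>
    gen_Fitting H \<subseteq> \<gamma> H"
begin

text \<open>A minimal counterexample has all its proper normal subgroups inside the centre, hence is
  nilpotent or quasisimple.\<close>

lemma gamma_central_imp_carrier:
  fixes C :: "nat monoid"
  assumes "group C" "finite (carrier C)" "gamma_length \<gamma> C < \<infinity>" "\<gamma> C \<subseteq> centre C"
  shows "\<gamma> C = carrier C"
  using assms
proof (induction "card (carrier C)" arbitrary: C rule: less_induct)
  case less
  note C = less.prems
  have sub: "\<gamma> C \<subseteq> carrier C"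
    using C(4) by (auto simp: centre_def)
  have central: "N \<subseteq> centre C" if N: "N \<lhd> C" "N \<noteq> carrier C" for N
  proof -
    let ?N = "C\<lparr>carrier := N\<rparr>"
    have NC: "N \<subseteq> carrier C"
      using N(1) normal_imp_subgroup subgroup.subset by blast
    have eq: "\<gamma> C \<inter> N = \<gamma> ?N"
      using hereditary C N by (simp add: hereditary_Plotkin_radical_def)
    have "\<gamma> ?N \<subseteq> centre ?N"
      unfolding eq[symmetric] using C(4) NC by (auto simp: centre_def)
    moreover have "card N < card (carrier C)"
      using N(2) NC C(2) by (simp add: psubset_card_mono psubsetI)
    moreover have "group ?N" "finite N"
      using C NC N(1) group.subgroup_imp_group normal_imp_subgroup finite_subset by blast+
    \<comment> \<open>The induction hypothesis applies to \<open>?N\<close>: its radical is central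
      by (P2), and it inherits finite length. Restricting the carrier keeps a
      \<open>nat monoid\<close>, so the induction stays within one type.\<close>
    ultimately have "\<gamma> ?N = N"
      using less.hyps[of ?N] gamma_length_finite_normal[OF C(1,2) N(1) C(3)] by simp
    then show ?thesis
      using eq C(4) by blast
  qed
  \<comment> \<open>The derived subgroup is normal, hence central or all of \<open>C\<close>. In the
    first case \<open>C\<close> is nilpotent; otherwise it is perfect with a proper centre, and
    \<open>quasisimpleI\<close> applies.\<close>
  have "nilpotent_group C \<or> quasisimple_group C"
  proof (cases "derived C (carrier C) \<subseteq> centre C")
    case True
    then show ?thesis
      using nilpotent_if_derived_central C by blast
  next
    case False
    then have "derived C (carrier C) = carrier C"
      using central group.derived_self_is_normal[OF C(1)] by blast
    moreover have "centre C \<noteq> carrier C"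
      using False group.derived_in_carrier[OF C(1)] by blast
    ultimately show ?thesis
      using quasisimpleI C central by blast
  qed
  then have "carrier C \<subseteq> gen_Fitting C"
    using gen_Fitting_nilpotent gen_Fitting_quasisimple by blast
  then show ?case
    using gen_Fitting_le[OF C(1-3)] sub by blast
qed

text \<open>By (P2) the centralizer \<open>?C\<close> has radical
  \<open>\<gamma> H \<inter> ?C\<close>, which is central in \<open>?C\<close>. So \<open>?C\<close>
  equals its own radical and lies in \<open>\<gamma> H\<close>. This is the counterpart of the
  classical fact that the generalized Fitting subgroup contains its centralizer.\<close>

lemma centralizer_gamma_le:
  fixes H :: "nat monoid"
  assumes H: "group H" "finite (carrier H)" "gamma_length \<gamma> H < \<infinity>"
  shows "{x \<in> carrier H. \<forall>y\<in>\<gamma> H. x \<otimes>\<^bsub>H\<^esub> y = y \<otimes>\<^bsub>H\<^esub> x} \<subseteq> \<gamma> H" (is "?C \<subseteq> _")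
proof -
  have "\<gamma> H \<lhd> H"
    using radical_normal[OF H(1,2)] radical_nat[OF functorial H(1,2)] by simp
  then have N: "?C \<lhd> H"
    by (rule centralizer_normal)
  let ?K = "H\<lparr>carrier := ?C\<rparr>"
  have eq: "\<gamma> H \<inter> ?C = \<gamma> ?K"
    using hereditary H N by (simp add: hereditary_Plotkin_radical_def)
  have "\<gamma> ?K \<subseteq> centre ?K"
    unfolding eq[symmetric] by (auto simp: centre_def)
  then have "\<gamma> ?K = carrier ?K"
    using gamma_central_imp_carrier[OF group.subgroup_imp_group[OF H(1) normal_imp_subgroup[OF N]] _
        gamma_length_finite_normal[OF H(1,2) N H(3)]] H(2) by simp
  then show ?thesis
    using eq by auto
qed

text \<open>Needed for quotients by terms of the \<gamma>-series, whose elements are cosets; finite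
  length and commutation both pass along an isomorphism to a group of natural numbers.\<close>

lemma centralizer_radical_le:
  fixes G :: "('a, 'b) monoid_scheme"
  assumes G: "group G" "finite (carrier G)" "gamma_length \<gamma> G < \<infinity>"
    and x: "x \<in> carrier G" "\<And>y. y \<in> radical \<gamma> G \<Longrightarrow> x \<otimes>\<^bsub>G\<^esub> y = y \<otimes>\<^bsub>G\<^esub> x"
  shows "x \<in> radical \<gamma> G"
proof -
  obtain H :: "nat monoid" and g where g: "group H" "finite (carrier H)" "g \<in> iso G H"
    using iso_to_nat_group G by blast
  have hom: "g \<in> hom G H"
    using g(3) by (simp add: iso_def)
  have fin: "gamma_length \<gamma> H < \<infinity>"
    using gamma_length_finite_epi[OF G(1,2) g(1) iso_imp_epi[OF g(3)] G(3)] .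
  have "g x \<otimes>\<^bsub>H\<^esub> z = z \<otimes>\<^bsub>H\<^esub> g x" if z: "z \<in> \<gamma> H" for z
  proof -
    obtain y where y: "y \<in> radical \<gamma> G" "z = g y"
      using radical_iso[OF functorial G(1,2) g(1,3)] z by blast
    then show ?thesis
      using x hom_mult[OF hom] radical_subset by (metis subsetD)
  qed
  then have "g x \<in> \<gamma> H"
    using centralizer_gamma_le[OF g(1,2) fin] hom_in_carrier[OF hom x(1)] by blast
  then show ?thesis
    using radical_eq[OF G(1,2) g(1,3)] x(1) by simp
qed

section \<open>Comparison of the series of a subgroup with that of the group\<close>

text \<open>\<open>?B\<close> and \<open>?R\<close> are both normal in \<open>?M\<close>, so
  commutators between them fall into \<open>?B \<inter> ?R\<close> and hence into \<open>?A\<close>.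
  Modulo \<open>?A\<close>, elements of \<open>?B\<close> therefore centralize the radical and
  belong to it.\<close>

lemma gamma_series_subgroup_le:
  fixes G :: "('a, 'b) monoid_scheme"
  assumes G: "group G" "finite (carrier G)" "gamma_length \<gamma> G < \<infinity>"
    and M: "subgroup M G" "gamma_series \<gamma> G (Suc k) \<subseteq> M"
  shows "gamma_series \<gamma> (G\<lparr>carrier := M\<rparr>) k \<subseteq> gamma_series \<gamma> G k"
proof
  note [simp del] = gamma_series.simps(2)
  let ?M = "G\<lparr>carrier := M\<rparr>" and ?A = "gamma_series \<gamma> G k" and ?R = "gamma_series \<gamma> G (Suc k)"
  let ?B = "gamma_series \<gamma> ?M k"
  fix x assume x: "x \<in> ?B"
  interpret group G by fact
  have finM: "group ?M" "finite (carrier ?M)"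
    using G(2) M(1) subgroup_imp_group finite_subset[OF subgroup.subset[OF M(1)]] by auto
  have A: "?A \<lhd> G" and R: "?R \<lhd> G" and B: "?B \<lhd> ?M"
    using gamma_series_normal[OF G(1,2)] gamma_series_normal[OF finM] by blast+
  interpret R: normal ?R G by fact
  interpret B: normal ?B ?M by fact
  have B': "subgroup ?B ?M"
    using B by (rule normal_imp_subgroup)
  have RM: "?R \<lhd> ?M"
    using normal_subset_restrict[OF G(1) R M] .
  have "?M\<lparr>carrier := ?R\<rparr> = G\<lparr>carrier := ?R\<rparr>"
    by simp
  \<comment> \<open>Heredity is used twice, for \<open>?R\<close> as a normal subgroup of
    \<open>?M\<close> and of \<open>G\<close>: both \<open>?B\<close> and \<open>?A\<close> meet
    \<open>?R\<close> in the \<open>k\<close>-th term of the series of \<open>?R\<close>.\<close>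
  then have BR: "?B \<inter> ?R \<subseteq> ?A"
    using gamma_series_Int_normal[OF finM RM, of k] gamma_series_Int_normal[OF G(1,2) R, of k]
    by (metis Int_lower1)
  have xM: "x \<in> M"
    using x B.subset by auto
  then have xG: "x \<in> carrier G"
    using subgroup.mem_carrier[OF M(1)] by blast
  let ?Q = "G Mod ?A"
  have comm: "(?A #>\<^bsub>G\<^esub> x) \<otimes>\<^bsub>?Q\<^esub> Y = Y \<otimes>\<^bsub>?Q\<^esub> (?A #>\<^bsub>G\<^esub> x)" if Y: "Y \<in> radical \<gamma> ?Q" for Y
  proof -
    obtain y where y: "y \<in> carrier G" "Y = ?A #>\<^bsub>G\<^esub> y"
      using subsetD[OF radical_subset Y] unfolding carrier_FactGroup by blast
    have yR: "y \<in> ?R"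
      unfolding gamma_series.simps(2) using y(1) Y[unfolded y(2)] by blast
    then have yM: "y \<in> M"
      using M(2) by blast
    \<comment> \<open>Bracketed from the left, the commutator is a product of elements of
      \<open>?R\<close>; bracketed from the right, a product of elements of
      \<open>?B\<close>.\<close>
    let ?c = "x \<otimes>\<^bsub>G\<^esub> y \<otimes>\<^bsub>G\<^esub> inv\<^bsub>G\<^esub> x \<otimes>\<^bsub>G\<^esub> inv\<^bsub>G\<^esub> y"
    have "?c \<in> ?R"
      by (rule R.m_closed[OF R.inv_op_closed2[OF xG yR] R.m_inv_closed[OF yR]])
    moreover have "x \<otimes>\<^bsub>G\<^esub> (y \<otimes>\<^bsub>G\<^esub> inv\<^bsub>G\<^esub> x \<otimes>\<^bsub>G\<^esub> inv\<^bsub>G\<^esub> y) \<in> ?B"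
      using subgroup.m_closed[OF B' x B.inv_op_closed2[of y "inv\<^bsub>?M\<^esub> x"]]
        subgroup.m_inv_closed[OF B' x] m_inv_consistent[OF M(1)] xM yM by simp
    moreover have "?c = x \<otimes>\<^bsub>G\<^esub> (y \<otimes>\<^bsub>G\<^esub> inv\<^bsub>G\<^esub> x \<otimes>\<^bsub>G\<^esub> inv\<^bsub>G\<^esub> y)"
      using xG y(1) by (simp add: m_assoc)
    ultimately have c: "?c \<in> ?A"
      using BR by auto
    have Asub: "?A \<subseteq> carrier G"
      using A normal_imp_subgroup subgroup.subset by blast
    have "x \<otimes>\<^bsub>G\<^esub> y = ?c \<otimes>\<^bsub>G\<^esub> (y \<otimes>\<^bsub>G\<^esub> x)"
    proof -
      have "inv\<^bsub>G\<^esub> y \<otimes>\<^bsub>G\<^esub> (y \<otimes>\<^bsub>G\<^esub> x) = x"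
        using xG y(1) by (simp add: m_assoc[symmetric])
      then show ?thesis
        using xG y(1) by (simp add: m_assoc)
    qed
    then have "?A #>\<^bsub>G\<^esub> (x \<otimes>\<^bsub>G\<^esub> y) = ?A #>\<^bsub>G\<^esub> (?c \<otimes>\<^bsub>G\<^esub> (y \<otimes>\<^bsub>G\<^esub> x))"
      by (rule arg_cong)
    also have "\<dots> = (?A #>\<^bsub>G\<^esub> ?c) #>\<^bsub>G\<^esub> (y \<otimes>\<^bsub>G\<^esub> x)"
      using xG y(1) Asub by (intro coset_mult_assoc[symmetric]) auto
    also have "?A #>\<^bsub>G\<^esub> ?c = ?A"
      using c Asub by (intro coset_join2 normal_imp_subgroup[OF A]) auto
    finally show ?thesis
      using normal.rcos_sum[OF A] xG y by simp
  qed
  have "?A #>\<^bsub>G\<^esub> x \<in> radical \<gamma> ?Q"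
    using centralizer_radical_le[OF normal.factorgroup_is_group[OF A] finite_Mod[OF G(2)]
        gamma_length_finite_epi[OF G(1,2) normal.factorgroup_is_group[OF A] Mod_epi[OF A] G(3)] _ comm]
      xG by (simp add: carrier_FactGroup)
  then have "x \<in> ?R"
    unfolding gamma_series.simps(2) using xG by blast
  \<comment> \<open>The centralizer argument only reaches \<open>?R\<close>; since \<open>x\<close>
    also lies in \<open>?B\<close>, the intersection brings it down to \<open>?A\<close>.\<close>
  then show "x \<in> ?A"
    using x BR by blast
qed

lemma gamma_series_maximal_subgroup:
  fixes G :: "('a, 'b) monoid_scheme"
  assumes G: "group G" "finite (carrier G)" "gamma_length \<gamma> G < \<infinity>"
    and max: "maximal_subgroup M G" and m: "gamma_series \<gamma> (G\<lparr>carrier := M\<rparr>) m = M"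
  shows "gamma_series \<gamma> G (m + 2) = carrier G"
proof -
  note [simp del] = gamma_series.simps(2)
  interpret group G by fact
  let ?M = "G\<lparr>carrier := M\<rparr>" and ?R = "gamma_series \<gamma> G"
  have M: "subgroup M G" "M \<noteq> carrier G"
    and Mmax: "\<And>K. subgroup K G \<Longrightarrow> M \<subseteq> K \<Longrightarrow> K = M \<or> K = carrier G"
    using max by (auto simp: maximal_subgroup_def)
  have MG: "M \<subseteq> carrier G"
    using M(1) by (rule subgroup.subset)
  have finM: "group ?M" "finite (carrier ?M)"
    using G(2) M(1) subgroup_imp_group finite_subset[OF MG] by auto
  obtain h where "?R h = carrier G"
    using gamma_length_finite_iff[THEN iffD1, OF G(3)] by blast
  then have "\<not> ?R h \<subseteq> M"
    using M(2) MG by blast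
  moreover have "?R 0 \<subseteq> M"
    using subgroup.one_closed[OF M(1)] by simp
  \<comment> \<open>The series starts inside \<open>M\<close> and ends at the whole group, so it
    leaves \<open>M\<close> right after some index \<open>i\<close>.\<close>
  ultimately obtain i where i: "?R i \<subseteq> M" "\<not> ?R (Suc i) \<subseteq> M"
    using nat_induct[of "\<lambda>i. ?R i \<subseteq> M" h] by blast
  let ?N = "?R (Suc i)"
  let ?Q = "G Mod ?N" and ?p = "(#>\<^bsub>G\<^esub>) ?N"
  have N: "?N \<lhd> G"
    using gamma_series_normal G by blast
  have Q: "group ?Q" "finite (carrier ?Q)"
    using normal.factorgroup_is_group[OF N] finite_Mod[OF G(2)] by blast+
  have NG: "subgroup ?N G" "?N \<subseteq> carrier G"
    using N normal_imp_subgroup subgroup.subset by blast+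
  \<comment> \<open>By maximality the product of \<open>?N\<close> and \<open>M\<close> is all of
    \<open>G\<close>. Every coset of \<open>?N\<close> then has a representative in
    \<open>M\<close>, so \<open>?p\<close> restricted to \<open>M\<close> is still onto
    \<open>?Q\<close>.\<close>
  have "subgroup (?N <#>\<^bsub>G\<^esub> M) G"
    using mult_norm_subgroup[OF N M(1)] .
  moreover have "M \<subseteq> ?N <#>\<^bsub>G\<^esub> M"
    using subgroup.one_closed[OF NG(1)] MG by (force simp: set_mult_def)
  moreover have "?N \<subseteq> ?N <#>\<^bsub>G\<^esub> M"
    using subgroup.one_closed[OF M(1)] NG(2) by (force simp: set_mult_def)
  ultimately have NM: "?N <#>\<^bsub>G\<^esub> M = carrier G"
    using Mmax i(2) by blast
  have "?p y \<in> ?p ` M" if y: "y \<in> carrier G" for y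
  proof -
    obtain n z where nz: "n \<in> ?N" "z \<in> M" "y = n \<otimes>\<^bsub>G\<^esub> z"
      using y unfolding NM[symmetric] set_mult_def by blast
    have n: "n \<in> carrier G"
      using nz(1) NG(2) by blast
    have "?p y = (?p n) #>\<^bsub>G\<^esub> z"
      unfolding nz(3) using n nz(2) MG NG(2) by (intro coset_mult_assoc[symmetric]) auto
    also have "?p n = ?N"
      using n NG(1) nz(1) by (rule coset_join2)
    finally show ?thesis
      using nz(2) by blast
  qed
  then have "?p ` M = carrier ?Q"
    using MG unfolding carrier_FactGroup by blast
  then have p: "?p \<in> epi ?M ?Q"
    using Mod_epi[OF N] MG by (simp add: epi_def hom_def subset_iff Pi_iff)
  \<comment> \<open>Once the \<open>k\<close>-th term of the series of \<open>M\<close> dies in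
    \<open>?Q\<close>, the remaining \<open>j\<close> steps exhaust \<open>?Q\<close>; lifting back
    to \<open>G\<close> adds the \<open>Suc i\<close> steps up to \<open>?N\<close>.\<close>
  have *: "?R (Suc i + j) = carrier G"
    if k: "gamma_series \<gamma> ?M k \<subseteq> ?N" "k + j = m" for k j
  proof -
    have "x \<in> kernel ?M ?Q ?p" if "x \<in> gamma_series \<gamma> ?M k" for x
      using that k(1) gamma_series_subset[OF finM] r_coset_eq_iff[OF N] MG
      by (simp add: kernel_def subset_iff)
    then have "?p ` M \<subseteq> gamma_series \<gamma> ?Q j"
      using gamma_series_epi[OF finM Q(1) p, of k j] k(2) m by blast
    then have "carrier ?Q \<subseteq> gamma_series \<gamma> ?Q j"
      using \<open>?p ` M = carrier ?Q\<close> by simp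
    then have "x \<in> ?R (Suc i + j)" if "x \<in> carrier G" for x
      using gamma_series_add_iff[OF G(1,2) Q(1) Mod_epi[OF N] kernel_Mod[OF N] that, of j] that
      by (auto simp: carrier_FactGroup)
    then show ?thesis
      using gamma_series_subset[OF G(1,2)] by blast
  qed
  show ?thesis
  proof (cases i)
    case 0
    \<comment> \<open>Here only the trivial term is used, and the resulting bound is even
      \<open>m + 1\<close>.\<close>
    have "gamma_series \<gamma> ?M 0 \<subseteq> ?N"
      using subgroup.one_closed[OF NG(1)] by simp
    then have "?R (Suc m) = carrier G"
      using *[of 0 m] 0 by simp
    then show ?thesis
      using gamma_series_mono[OF G(1,2), of "Suc m" "m + 2"] gamma_series_subset[OF G(1,2), of "m + 2"]
      by simp
  next
    case (Suc k)
    have le: "gamma_series \<gamma> ?M k \<subseteq> ?R k"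
      using gamma_series_subgroup_le[OF G M(1)] i(1) Suc by simp
    show ?thesis
    proof (cases "k \<le> m")
      case True
      have "gamma_series \<gamma> ?M k \<subseteq> ?N"
        using le gamma_series_mono[OF G(1,2), of k "Suc i"] Suc by auto
      \<comment> \<open>The bound 2 arises here: \<open>i = k + 1\<close> gives
        \<open>Suc i + (m - k) = m + 2\<close>.\<close>
      then show ?thesis
        using *[of k "m - k"] True Suc by simp
    next
      case False
      \<comment> \<open>This case is contradictory. The series of \<open>M\<close> has reached
        \<open>M\<close> before index \<open>k\<close>, so \<open>M\<close> lies in
        \<open>?R k\<close>, while \<open>?R (Suc k)\<close> lies in \<open>M\<close>. The series of
        \<open>G\<close> then stalls at \<open>k\<close>, against the choice of
        \<open>i\<close>.\<close>
      then have "M \<subseteq> ?R k"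
        using gamma_series_mono[OF finM, of m k] m le by auto
      then have eq: "?R (Suc k) = ?R k"
        using gamma_series_mono[OF G(1,2), of k "Suc k"] i(1) Suc by auto
      have "?R (Suc (Suc k)) = ?R (Suc k)"
        unfolding gamma_series.simps(2)[of \<gamma> G "Suc k"] eq
        by (rule eq[unfolded gamma_series.simps(2)])
      then show ?thesis
        using i Suc by simp
    qed
  qed
qed

end

theorem theorem2:
  fixes \<gamma> :: group_function and G :: "('a, 'b) monoid_scheme" and M :: "'a set"
  assumes "hereditary_Plotkin_radical \<gamma>"
    and "\<And>H :: nat monoid. group H \<Longrightarrow> finite (carrier H) \<Longrightarrow> gamma_length \<gamma> H < \<infinity> \<Longrightarrow>
           gen_Fitting H \<subseteq> \<gamma> H"
    and "group G" and "finite (carrier G)"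
    and "maximal_subgroup M G"
    and "gamma_length \<gamma> G < \<infinity>" and "gamma_length \<gamma> (G\<lparr>carrier := M\<rparr>) < \<infinity>"
  shows "int (the_enat (gamma_length \<gamma> G)) - int (the_enat (gamma_length \<gamma> (G\<lparr>carrier := M\<rparr>))) \<le> 2"
proof -
  interpret gen_Fitting_radical \<gamma>
    using assms(1,2) by unfold_locales
  \<comment> \<open>Finiteness excludes the infinite branch of \<open>gamma_length\<close>, so
    \<open>the_enat\<close> returns an honest least index and \<open>LeastI\<close> and
    \<open>Least_le\<close> become available.\<close>
  have length: "the_enat (gamma_length \<gamma> K) = (LEAST h. gamma_series \<gamma> K h = carrier K)"
    if "gamma_length \<gamma> K < \<infinity>" for K :: "('a, 'b) monoid_scheme"
    using that by (auto simp: gamma_length_def split: if_splits)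
  define m where "m = the_enat (gamma_length \<gamma> (G\<lparr>carrier := M\<rparr>))"
  obtain h where "gamma_series \<gamma> (G\<lparr>carrier := M\<rparr>) h = carrier (G\<lparr>carrier := M\<rparr>)"
    using gamma_length_finite_iff[THEN iffD1, OF assms(7)] by blast
  then have "gamma_series \<gamma> (G\<lparr>carrier := M\<rparr>) m = carrier (G\<lparr>carrier := M\<rparr>)"
    unfolding m_def length[OF assms(7)] by (rule LeastI)
  then have "gamma_series \<gamma> G (m + 2) = carrier G"
    using gamma_series_maximal_subgroup[OF assms(3,4,6,5)] by simp
  then have "the_enat (gamma_length \<gamma> G) \<le> m + 2"
    unfolding length[OF assms(6)] by (rule Least_le)
  then show ?thesis
    unfolding m_def by linarith
qed

end
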